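(* Let $a\ge1$ be an even integer, $b\ge1$ an odd integer, and $n>1$ an odd integer. Then the Horadam cube $\Pi^{a,b}_n$ is Hamiltonian.
   Context: For integers $a,b\ge1$ and $n\ge 0$, $\mathcal S^{a,b}_n$ is the set of all strings of length $n$ over the alphabet $\{0,1,\dots,a+b-1\}$ in which every letter from $\{a,\dots,a+b-1\}$ appears only immediately after a letter $0$. The Horadam cube $\Pi^{a,b}_n$ is the simple graph with vertex set $\mathcal S^{a,b}_n$ in which $x_1\cdots x_n$ and $y_1\cdots y_n$ are adjacent if and only if $\sum_{i=1}^n|x_i-y_i|=1$. A graph is Hamiltonian if it contains a cycle visiting each vertex exactly once. *)

theory Defs
  imports Main "Graph_Theory.Graph_Theory"
begin

definition horadam_strings :: "nat \<Rightarrow> nat \<Rightarrow> nat \<Rightarrow> nat list set" where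
  "horadam_strings a b n =
     {x. length x = n \<and> set x \<subseteq> {0..<a + b} \<and>
         (\<forall>i<n. x ! i \<in> {a..<a + b} \<longrightarrow> 0 < i \<and> x ! (i - 1) = 0)}"

text \<open>A simple graph is represented by its symmetric digraph: each undirected edge
  contributes both of its orientations as arcs.\<close>

definition horadam_cube :: "nat \<Rightarrow> nat \<Rightarrow> nat \<Rightarrow> nat list pair_pre_digraph" where
  "horadam_cube a b n =
     \<lparr> pverts = horadam_strings a b n,
       parcs = {(x, y). x \<in> horadam_strings a b n \<and> y \<in> horadam_strings a b n \<and>
                        (\<Sum>i<n. \<bar>int (x ! i) - int (y ! i)\<bar>) = 1} \<rparr>"

text \<open>For a symmetric digraph, \<^const>\<open>pre_digraph.cycle\<close> also admits the closed walk
  \<open>u, v, u\<close> along a single undirected edge; the length bound excludes it. That no vertex is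
  visited twice is part of \<^const>\<open>pre_digraph.cycle\<close>.\<close>

definition hamiltonian :: "('a, 'b) pre_digraph \<Rightarrow> bool" where
  "hamiltonian G \<longleftrightarrow>
     (\<exists>p. pre_digraph.cycle G p \<and> 3 \<le> length p \<and> tail G ` set p = verts G)"

lemma finite_horadam_strings: "finite (horadam_strings a b n)"
proof (rule finite_subset)
  show "horadam_strings a b n \<subseteq> {x. set x \<subseteq> {0..<a + b} \<and> length x = n}"
    by (auto simp: horadam_strings_def)
qed (rule finite_lists_length_eq, simp)

lemma pair_graph_horadam_cube: "pair_graph (horadam_cube a b n)"
proof
  show "finite (pverts (horadam_cube a b n))"
    by (simp add: horadam_cube_def finite_horadam_strings)
  show "finite (parcs (horadam_cube a b n))"
    by (rule finite_subset[of _ "horadam_strings a b n \<times> horadam_strings a b n"])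
       (auto simp: horadam_cube_def finite_horadam_strings)
  show "symmetric (with_proj (horadam_cube a b n))"
    by (auto simp: symmetric_conv horadam_cube_def abs_minus_commute)
qed (auto simp: horadam_cube_def)

end

theory Submission
  imports Defs
begin

text \<open>
  Prepending letters \<open>0, \<dots>, a - 1\<close> to the strings of length \<open>n + 1\<close>, and the blocks
  \<open>0 k\<close> with \<open>a \<le> k < a + b\<close> to those of length \<open>n\<close>, yields each string of length
  \<open>n + 2\<close> once. As \<open>a\<close> is even, traversing these copies back and forth in the order
  \<open>a - 1, \<dots>, 0, 0 a, \<dots>, 0 (a + b - 1)\<close> gives Hamiltonian paths \<open>\<alpha>\<^sub>n\<close>, all starting at the
  constant string of letters \<open>a - 1\<close>.

  For odd \<open>n = m + 2\<close>, the copies \<open>k \<alpha>\<^sub>m\<^sub>+\<^sub>1\<close> with \<open>k < a\<close> form a grid with an even number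
  of rows, which has a Hamiltonian cycle running through the whole row \<open>k = 0\<close>. This row begins with
  \<open>0 (a - 1) \<alpha>\<^sub>m\<close>, which has an even number of vertices; pairing up consecutive ones,
  each edge of the pairing is replaced by a detour up and down the columns
  \<open>0 k x\<close> for \<open>k = a - 1, \<dots>, a + b - 1\<close>.
\<close>

section \<open>Boustrophedon traversal of a grid\<close>

text \<open>Rows and columns are arbitrary label lists, so that the rows can be indexed by letters
  or, with the roles exchanged as in \<open>C1\<close> below, by strings.\<close>

fun snake :: "('k \<Rightarrow> 'x \<Rightarrow> 'v) \<Rightarrow> 'k list \<Rightarrow> 'x list \<Rightarrow> 'v list" where
  "snake f [] xs = []"
| "snake f (k # ks) xs = map (f k) xs @ snake f ks (rev xs)"

lemma set_snake: "set (snake f ks xs) = (\<Union>k\<in>set ks. f k ` set xs)"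
  by (induction ks arbitrary: xs) auto

lemma length_snake: "length (snake f ks xs) = length ks * length xs"
  by (induction ks arbitrary: xs) auto

lemma snake_eq_Nil_iff: "snake f ks xs = [] \<longleftrightarrow> ks = [] \<or> xs = []"
  using length_snake[of f ks xs] by (metis length_0_conv mult_eq_0_iff)

lemma hd_snake: "ks \<noteq> [] \<Longrightarrow> xs \<noteq> [] \<Longrightarrow> hd (snake f ks xs) = f (hd ks) (hd xs)"
  by (cases ks) (auto simp: hd_map)

lemma last_snake:
  assumes "ks \<noteq> []" "xs \<noteq> []"
  shows "last (snake f ks xs) = f (last ks) (if odd (length ks) then last xs else hd xs)"
  using assms
proof (induction ks arbitrary: xs)
  case (Cons k ks)
  then show ?case
    by (cases "ks = []") (auto simp: snake_eq_Nil_iff last_map hd_rev last_rev)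
qed simp

lemma distinct_snake:
  assumes "\<And>k x k' x'. f k x = f k' x' \<Longrightarrow> k = k' \<and> x = x'"
    and "distinct ks" "distinct xs"
  shows "distinct (snake f ks xs)"
  using assms(2,3)
proof (induction ks arbitrary: xs)
  case (Cons k ks)
  have "inj_on (f k) (set xs)"
    using assms(1) by (meson inj_onI)
  then show ?case
    using Cons assms(1) by (fastforce simp: distinct_map set_snake)
qed simp

text \<open>Each row starts in the column where the previous one ended, so a single vertical step
  joins them. Symmetry of \<open>R\<close> allows rows to be run backwards.\<close>

lemma successively_snake:
  assumes "symp R"
    and "\<And>k. k \<in> set ks \<Longrightarrow> successively R (map (f k) xs)"
    and "\<And>x. x \<in> set xs \<Longrightarrow> successively R (map (\<lambda>k. f k x) ks)"
  shows "successively R (snake f ks xs)"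
  using assms(2,3)
proof (induction ks arbitrary: xs)
  case (Cons k ks)
  have "successively R (snake f ks (rev xs))"
  proof (rule Cons.IH)
    fix l assume "l \<in> set ks"
    then have "successively R (map (f l) xs)"
      using Cons.prems by simp
    then show "successively R (map (f l) (rev xs))"
      by (auto simp: rev_map[symmetric] intro: successively_mono sympD[OF assms(1)])
  next
    fix x assume "x \<in> set (rev xs)"
    then show "successively R (map (\<lambda>k. f k x) ks)"
      using Cons.prems(2)[of x] by (auto simp: successively_Cons)
  qed
  moreover have "R (f k (last xs)) (f (hd ks) (last xs))" if "xs \<noteq> []" "ks \<noteq> []"
    using Cons.prems(2)[of "last xs"] that by (auto simp: successively_Cons hd_map)
  ultimately show ?case
    using Cons.prems(1)
    by (auto simp: successively_append_iff snake_eq_Nil_iff hd_snake last_map hd_rev)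
qed simp

section \<open>Adjacency and the recursive structure of the strings\<close>

text \<open>Membership in the vertex set is left out so that common first letters can be stripped
  freely; it is restored only when arcs of the cube are needed.\<close>

definition cube_adj :: "nat list \<Rightarrow> nat list \<Rightarrow> bool" where
  "cube_adj x y \<longleftrightarrow> length x = length y \<and> (\<Sum>i<length x. \<bar>int (x ! i) - int (y ! i)\<bar>) = 1"

lemma symp_cube_adj: "symp cube_adj"
  by (auto simp: symp_def cube_adj_def abs_minus_commute)

lemma cube_adj_Cons_same [simp]: "cube_adj (k # x) (k # y) \<longleftrightarrow> cube_adj x y"
  by (simp add: cube_adj_def sum.lessThan_Suc_shift del: sum.lessThan_Suc)

lemma cube_adj_Cons_Cons [simp]: "cube_adj (k # x) (l # x) \<longleftrightarrow> \<bar>int k - int l\<bar> = 1"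
  by (simp add: cube_adj_def sum.lessThan_Suc_shift del: sum.lessThan_Suc)

lemma successively_upt: "(\<And>i. P i (Suc i)) \<Longrightarrow> successively P [m..<n]"
  by (auto simp: successively_conv_nth)

lemma horadam_strings_0: "horadam_strings a b 0 = {[]}"
  by (auto simp: horadam_strings_def)

lemma horadam_strings_Suc_0: "horadam_strings a b (Suc 0) = (\<lambda>k. [k]) ` {..<a}"
  by (auto simp: horadam_strings_def length_Suc_conv)

text \<open>\<open>(k # x) ! i\<close> is the letter in front of \<open>x ! i\<close>; the first
  letter \<open>k\<close> has none and must therefore be below \<open>a\<close>.\<close>

lemma horadam_strings_Cons_iff:
  "k # x \<in> horadam_strings a b (Suc n) \<longleftrightarrow>
     k < a \<and> length x = n \<and> set x \<subseteq> {..<a + b} \<and>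
     (\<forall>i<n. a \<le> x ! i \<longrightarrow> (k # x) ! i = 0)"
proof -
  have "x ! i < a + b" if "length x = n" "set x \<subseteq> {..<a + b}" "i < n" for i
    using that by (auto dest: nth_mem)
  then show ?thesis
    unfolding horadam_strings_def
    by (auto simp: All_less_Suc2 atLeast0LessThan cong: conj_cong)
qed

lemma horadam_strings_Suc_Suc:
  assumes "a > 0"
  shows "horadam_strings a b (Suc (Suc n)) =
    (\<Union>k\<in>{..<a}. (#) k ` horadam_strings a b (Suc n)) \<union>
    (\<Union>k\<in>{a..<a + b}. (\<lambda>x. 0 # k # x) ` horadam_strings a b n)" (is "?L = ?R")
proof (rule set_eqI)
  fix w
  \<comment> \<open>As \<open>a > 0\<close>, a letter \<open>l\<close> with \<open>a \<le> l\<close>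
    is nonzero, so the letter after it is restricted exactly as at the beginning of a
    string.\<close>
  have tail: "x \<in> horadam_strings a b n \<longleftrightarrow>
      length x = n \<and> set x \<subseteq> {..<a + b} \<and> (\<forall>i<n. a \<le> x ! i \<longrightarrow> (l # x) ! i = 0)"
    if "a \<le> l" for l x
  proof (cases n)
    case 0
    then show ?thesis by (auto simp: horadam_strings_0)
  next
    case (Suc n')
    show ?thesis
    proof (cases x)
      case Nil
      then show ?thesis using Suc by (auto simp: horadam_strings_def)
    next
      case (Cons k y)
      have "k < a \<longleftrightarrow> k < a + b \<and> (a \<le> k \<longrightarrow> l = 0)"
        using that assms by auto
      then show ?thesis
        by (auto simp: Suc Cons horadam_strings_Cons_iff All_less_Suc2)
    qed
  qed
  show "w \<in> ?L \<longleftrightarrow> w \<in> ?R"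
  proof (cases "length w = Suc (Suc n)")
    case True
    then obtain k l x where w: "w = k # l # x" by (auto simp: length_Suc_conv)
    show ?thesis
      unfolding w by (cases "a \<le> l")
        (use assms tail[of l x] in \<open>auto simp: horadam_strings_Cons_iff All_less_Suc2 image_iff\<close>)
  next
    case False
    then show ?thesis by (auto simp: horadam_strings_def)
  qed
qed

section \<open>Hamiltonian paths\<close>

fun gray :: "nat \<Rightarrow> nat \<Rightarrow> nat \<Rightarrow> nat list list" where
  "gray a b 0 = [[]]"
| "gray a b (Suc 0) = map (\<lambda>k. [k]) (rev [0..<a])"
| "gray a b (Suc (Suc n)) =
     snake (#) (rev [0..<a]) (gray a b (Suc n)) @
     snake (\<lambda>k x. 0 # k # x) [a..<a + b] (gray a b n)"

lemma set_gray: "a > 0 \<Longrightarrow> set (gray a b n) = horadam_strings a b n"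
proof (induction a b n rule: gray.induct)
  case (3 a b n)
  then show ?case
    by (simp add: set_snake horadam_strings_Suc_Suc lessThan_atLeast0)
qed (auto simp: horadam_strings_0 horadam_strings_Suc_0)

lemma hd_less_if_horadam_string: "k # x \<in> horadam_strings a b n \<Longrightarrow> k < a"
  by (cases n) (auto simp: horadam_strings_Cons_iff horadam_strings_0)

text \<open>The two snakes are disjoint because the second letter is below \<open>a\<close> in the
  first and at least \<open>a\<close> in the second.\<close>

lemma distinct_gray: "a > 0 \<Longrightarrow> distinct (gray a b n)"
proof (induction a b n rule: gray.induct)
  case (3 a b n)
  then show ?case
    by (auto simp: set_snake set_gray intro!: distinct_snake dest!: hd_less_if_horadam_string)
qed (auto simp: distinct_map inj_on_def)

lemma gray_neq_Nil [simp]: "a > 0 \<Longrightarrow> gray a b n \<noteq> []"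
  by (induction a b n rule: gray.induct) (auto simp: snake_eq_Nil_iff)

text \<open>The row of the letter \<open>a - 1\<close> comes first, and \<open>a \<ge> 2\<close>
  leaves something after it. Behind a 0, this copy lies next to the blocks \<open>0 a x\<close>,
  which is where paths and cycle pass over to them.\<close>

lemma gray_Suc:
  assumes "a \<ge> 2"
  obtains r where "gray a b (Suc n) = map ((#) (a - 1)) (gray a b n) @ r" "r \<noteq> []"
proof (cases n)
  case 0
  have "rev [0..<a] = (a - 1) # rev [0..<a - 1]"
    using assms by (cases a) auto
  with 0 assms that show ?thesis by auto
next
  case (Suc n')
  have "rev [0..<a] = (a - 1) # rev [0..<a - 1]"
    using assms by (cases a) auto
  with Suc assms that show ?thesis by (auto simp: snake_eq_Nil_iff)
qed

lemma successively_gray: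
  assumes "a > 0" "even a"
  shows "successively cube_adj (gray a b n)"
  using assms
proof (induction a b n rule: gray.induct)
  case (2 a b)
  then show ?case
    by (auto simp: rev_map[symmetric] successively_map intro!: successively_upt)
next
  case (3 a b n)
  have a2: "a \<ge> 2" using 3 by auto
  obtain r where r: "gray a b (Suc n) = map ((#) (a - 1)) (gray a b n) @ r"
    using gray_Suc[OF a2] by metis
  have rows: "successively cube_adj (snake (#) (rev [0..<a]) (gray a b (Suc n)))"
    using 3 by (intro successively_snake)
      (auto simp: symp_cube_adj successively_map intro!: successively_upt)
  have blocks: "successively cube_adj (snake (\<lambda>k x. 0 # k # x) [a..<a + b] (gray a b n))"
    using 3 by (intro successively_snake)
      (auto simp: symp_cube_adj successively_map intro!: successively_upt)
  \<comment> \<open>An even number of rows ends in the column of the head. As that head begins with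
    \<open>a - 1\<close>, the next vertex \<open>0 # a # hd (gray a b n)\<close> is one step away in
    the second letter.\<close>
  have "last (snake (#) (rev [0..<a]) (gray a b (Suc n))) = 0 # (a - 1) # hd (gray a b n)"
    using 3 r by (subst last_snake) (auto simp: last_rev hd_map)
  then show ?case
    using 3 rows blocks
    by (cases "b = 0") (auto simp: successively_append_iff snake_eq_Nil_iff hd_snake)
qed simp

lemma length_gray: "even a \<Longrightarrow> odd n \<Longrightarrow> even (length (gray a b n))"
  by (induction a b n rule: gray.induct) (auto simp: length_snake)

section \<open>Hamiltonian cycles\<close>

lemma cas_vwalk_arcs:
  "pre_digraph.cas (with_proj G) u (vwalk_arcs (u # xs)) (last (u # xs))"
  by (induction xs arbitrary: u) (auto simp: pre_digraph.cas.simps)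

lemma map_fst_vwalk_arcs: "map fst (vwalk_arcs xs) = butlast xs"
  by (induction xs rule: vwalk_arcs.induct) auto

lemma map_snd_vwalk_arcs: "map snd (vwalk_arcs xs) = tl xs"
  by (induction xs rule: vwalk_arcs.induct) auto

lemma set_vwalk_arcs_subset_iff:
  "set (vwalk_arcs xs) \<subseteq> A \<longleftrightarrow> successively (\<lambda>u v. (u, v) \<in> A) xs"
  by (induction xs rule: vwalk_arcs.induct) auto

text \<open>Closing \<open>vs\<close> by repeating its first vertex \<open>u\<close> gives arcs with
  tails \<open>vs\<close> and heads \<open>xs @ [u]\<close>. The tails show that every vertex is
  visited, the heads that none is repeated.\<close>

lemma hamiltonianI:
  assumes "distinct vs" "3 \<le> length vs" "set vs = pverts G"
    and "successively (\<lambda>u v. (u, v) \<in> parcs G) vs" "(last vs, hd vs) \<in> parcs G"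
  shows "hamiltonian (with_proj G)"
proof -
  obtain u xs where vs: "vs = u # xs" "xs \<noteq> []"
    using assms(2) by (cases vs) force+
  let ?p = "vwalk_arcs (vs @ [u])"
  have cas: "pre_digraph.cas (with_proj G) u ?p u"
    using cas_vwalk_arcs[of G u "xs @ [u]"] vs by simp
  have len: "length ?p = length vs"
    using arg_cong[OF map_fst_vwalk_arcs[of "vs @ [u]"], of length] by simp
  have "successively (\<lambda>u v. (u, v) \<in> parcs G) (vs @ [u])"
    using assms(4,5) vs by (simp add: successively_append_iff del: append_Cons)
  then have "set ?p \<subseteq> parcs G"
    by (simp add: set_vwalk_arcs_subset_iff)
  with cas have "pre_digraph.awalk (with_proj G) u ?p u"
    using assms(3) vs by (auto simp: pre_digraph.awalk_def)
  moreover have "tl (pre_digraph.awalk_verts (with_proj G) u ?p) = xs @ [u]"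
    using pre_digraph.awalk_verts_conv'[OF cas] map_snd_vwalk_arcs[of "vs @ [u]"] len vs
    by auto
  ultimately have "pre_digraph.cycle (with_proj G) ?p"
    using assms(1) vs by (auto simp: pre_digraph.cycle_def)
  moreover have "fst ` set ?p = pverts G"
    using arg_cong[OF map_fst_vwalk_arcs[of "vs @ [u]"], of set] assms(3) by simp
  ultimately show ?thesis
    using len assms(2) unfolding hamiltonian_def by auto
qed

lemma hamiltonian_horadam_cube:
  assumes "a \<ge> 2" "even a" "odd m"
  shows "hamiltonian (with_proj (horadam_cube a b (Suc (Suc m))))"
proof -
  define G where "G = gray a b m"
  define A where "A = gray a b (Suc m)"
  obtain r where r: "A = map ((#) (a - 1)) G @ r" "r \<noteq> []"
    using gray_Suc[OF assms(1)] unfolding A_def G_def by metis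
  have a0: "a > 0" using assms by simp
  have G: "G \<noteq> []" "distinct G" "successively cube_adj G" "even (length G)"
      "set G = horadam_strings a b m"
    using a0 assms by (auto simp: G_def distinct_gray successively_gray length_gray set_gray)
  have A: "A \<noteq> []" "distinct A" "successively cube_adj A" "set A = horadam_strings a b (Suc m)"
    using a0 assms by (auto simp: A_def distinct_gray successively_gray set_gray)
  have hdA: "hd A = (a - 1) # hd G" using r G by (simp add: hd_map)
  have tlA: "tl A \<noteq> []" using r G by (cases G) auto
  have A_eq: "A = hd A # tl A" using A(1) by simp
  have upt: "[a - 1..<a + b] = (a - 1) # [a..<a + b]"
    using a0 by (simp add: upt_conv_Cons)
  \<comment> \<open>\<open>C1\<close> covers the first copy in row 0 together with all blocks
    \<open>0 k x\<close>; since \<open>G\<close> has even length, it ends back at layer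
    \<open>a - 1\<close>. \<open>C2\<close> completes row 0. \<open>C3\<close> runs through the rows
    1 to \<open>a - 1\<close> without the first column; their number is odd, so it ends beside that
    column, which \<open>C4\<close> descends to return to the start.\<close>
  define C1 where "C1 = snake (\<lambda>x k. 0 # k # x) G [a - 1..<a + b]"
  define C2 where "C2 = map ((#) 0) r"
  define C3 where "C3 = snake (#) [1..<a] (rev (tl A))"
  define C4 where "C4 = map (\<lambda>k. k # hd A) (rev [1..<a])"
  have ne: "C1 \<noteq> []" "C2 \<noteq> []" "C3 \<noteq> []" "C4 \<noteq> []"
    using G r tlA assms(1) upt
    by (auto simp: C1_def C2_def C3_def C4_def snake_eq_Nil_iff)
  have ends1: "hd C1 = 0 # hd A" "last C1 = 0 # (a - 1) # last G"
    using G upt hdA by (auto simp: C1_def hd_snake last_snake)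
  have ends2: "hd C2 = 0 # hd r" "last C2 = 0 # last A"
    using r by (auto simp: C2_def hd_map last_map)
  have "last (tl A) = last A" using tlA by (simp add: last_tl)
  then have ends3: "hd C3 = 1 # last A" "last C3 = (a - 1) # hd (tl A)"
    using tlA assms(1,2) by (auto simp: C3_def hd_snake last_snake hd_rev last_rev)
  have ends4: "hd C4 = (a - 1) # hd A" "last C4 = 1 # hd A"
    using assms(1) by (auto simp: C4_def hd_map last_map hd_rev last_rev)
  note ends = ends1 ends2 ends3 ends4
  have "successively cube_adj (map ((#) (a - 1)) G @ r)" using A r by simp
  then have r_walk: "cube_adj ((a - 1) # last G) (hd r)" "successively cube_adj r"
    using G r by (auto simp: successively_append_iff last_map)
  have tl_walk: "cube_adj (hd A) (hd (tl A))" "successively cube_adj (tl A)"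
    using A(3) tlA by (subst (asm) A_eq, simp add: successively_Cons)+
  have s1: "successively cube_adj C1"
    unfolding C1_def using G(3) by (intro successively_snake)
      (auto simp: symp_cube_adj successively_map simp del: upt_Suc intro!: successively_upt)
  have s2: "successively cube_adj C2"
    using r_walk by (simp add: C2_def successively_map)
  have s3: "successively cube_adj C3"
    unfolding C3_def using tl_walk symp_cube_adj
    by (intro successively_snake)
      (auto simp: successively_map simp del: upt_Suc
        intro!: successively_upt intro: successively_mono sympD)
  have s4: "successively cube_adj C4"
    unfolding C4_def by (auto simp: successively_map intro!: successively_upt)
  let ?C = "C1 @ C2 @ C3 @ C4"
  \<comment> \<open>The joints are the edge of \<open>A\<close> leading into \<open>r\<close>, the
    step from row 0 to row 1 at \<open>last A\<close>, and the first edge of \<open>A\<close> taken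
    backwards in row \<open>a - 1\<close>.\<close>
  have walk: "successively cube_adj ?C"
    using s1 s2 s3 s4 ne ends r_walk tl_walk symp_cube_adj
    by (auto simp: successively_append_iff intro: sympD)
  have closed: "cube_adj (last ?C) (hd ?C)"
    using ne ends by simp
  have setA: "set A = insert (hd A) (set (tl A))"
    using arg_cong[OF A_eq, of set] by simp
  \<comment> \<open>Layer \<open>a - 1\<close> of \<open>C1\<close> is the part of row 0 that
    \<open>C2\<close> lacks; the other layers are the blocks in
    \<open>horadam_strings_Suc_Suc\<close>.\<close>
  have "{a - 1..<a + b} = insert (a - 1) {a..<a + b}" using a0 by auto
  then have set1: "set C1 = (#) 0 ` (#) (a - 1) ` set G \<union>
      (\<Union>k\<in>{a..<a + b}. (\<lambda>x. 0 # k # x) ` set G)"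
    unfolding C1_def set_snake set_upt by auto
  have set34: "set C3 \<union> set C4 = (\<Union>k\<in>{1..<a}. (#) k ` set A)"
    unfolding C3_def C4_def setA by (auto simp: set_snake)
  have "set A = (#) (a - 1) ` set G \<union> set r" using r by auto
  then have set12: "set C1 \<union> set C2 = (#) 0 ` set A \<union>
      (\<Union>k\<in>{a..<a + b}. (\<lambda>x. 0 # k # x) ` set G)"
    unfolding set1 C2_def by auto
  have "{..<a} = insert 0 {1..<a}" using a0 by auto
  then have "horadam_strings a b (Suc (Suc m)) = (set C1 \<union> set C2) \<union> (set C3 \<union> set C4)"
    unfolding set12 set34 horadam_strings_Suc_Suc[OF a0] A(4) G(5) by auto
  then have set: "set ?C = horadam_strings a b (Suc (Suc m))"
    by auto
  have "distinct (map ((#) (a - 1)) G @ r)" using A r by simp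
  then have r_new: "distinct r" "\<And>x. x \<in> set G \<Longrightarrow> (a - 1) # x \<notin> set r" by auto
  have r_less: "k < a" if "k # x \<in> set r" for k x
    using that r A(4) by (auto intro: hd_less_if_horadam_string)
  have tl_new: "distinct (tl A)" "hd A \<notin> set (tl A)"
    using A(2) by (subst (asm) A_eq, simp)+
  have d1: "distinct C1"
    unfolding C1_def using G by (intro distinct_snake) auto
  have d3: "distinct C3"
    unfolding C3_def using tl_new by (intro distinct_snake) auto
  have disj: "set C1 \<inter> set C2 = {}"
  proof -
    \<comment> \<open>For \<open>k = a - 1\<close>, distinctness of \<open>A\<close> separates the
      first copy from \<open>r\<close>; a larger \<open>k\<close> cannot begin a string of
      \<open>A\<close>.\<close>
    have False if "k \<ge> a - 1" "x \<in> set G" "k # x \<in> set r" for k x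
      using that r_new(2) r_less[of k x] by (cases "k = a - 1") auto
    then show ?thesis by (auto simp: C1_def C2_def set_snake)
  qed
  have "distinct ?C"
    using d1 d3 disj tl_new r_new(1)
    by (auto simp: C1_def C2_def C3_def C4_def set_snake distinct_map inj_on_def)
  moreover have "length ?C \<ge> 3"
    using ne by (auto simp: neq_Nil_conv)
  moreover have adj: "(x, y) \<in> parcs (horadam_cube a b (Suc (Suc m)))"
    if "cube_adj x y" "x \<in> set ?C" "y \<in> set ?C" for x y
    using that unfolding set
    by (auto simp: horadam_cube_def cube_adj_def horadam_strings_def)
  moreover have "successively (\<lambda>u v. (u, v) \<in> parcs (horadam_cube a b (Suc (Suc m)))) ?C"
    using walk adj by (rule successively_mono)
  moreover have "(last ?C, hd ?C) \<in> parcs (horadam_cube a b (Suc (Suc m)))"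
    using closed ne by (intro adj) auto
  ultimately show ?thesis
    using set by (intro hamiltonianI[of ?C]) (auto simp: horadam_cube_def)
qed

theorem theorem16:
  fixes a b n :: nat
  assumes "a \<ge> 1" and "even a"
    and "b \<ge> 1" and "odd b"
    and "n > 1" and "odd n"
  shows "hamiltonian (with_proj (horadam_cube a b n))"
proof -
  obtain m where "n = Suc (Suc m)"
    using \<open>n > 1\<close> by (auto dest!: less_imp_Suc_add)
  moreover have "a \<ge> 2"
    using \<open>a \<ge> 1\<close> \<open>even a\<close> by presburger
  ultimately show ?thesis
    using \<open>even a\<close> \<open>odd n\<close> by (auto intro: hamiltonian_horadam_cube)
qed

end
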